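(* There exists a $2$-$(694,7,2)$ design.
   Context: A $2$-$(v,k,\lambda)$ design is a pair $(V,\mathcal{A})$ where $V$ is a set of $v$ points and $\mathcal{A}$ is a collection (multiset) of $k$-subsets of $V$ (blocks) such that every $2$-subset of $V$ is contained in exactly $\lambda$ blocks of $\mathcal{A}$. *)

theory Defs
  imports "HOL-Library.Multiset"
begin

text \<open>
  Blocks form a multiset, so repeated blocks are allowed and are counted with multiplicity.
\<close>

definition two_design :: "nat \<Rightarrow> nat \<Rightarrow> nat \<Rightarrow> 'a set \<Rightarrow> 'a set multiset \<Rightarrow> bool" where
  "two_design v k l V \<A> \<longleftrightarrow>
     finite V \<and> card V = v \<and>
     (\<forall>B \<in># \<A>. B \<subseteq> V \<and> card B = k) \<and>
     (\<forall>T. T \<subseteq> V \<and> card T = 2 \<longrightarrow> size {# B \<in># \<A>. T \<subseteq> B #} = l)"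

end

theory Submission
  imports Defs "HOL-Number_Theory.Cong"
begin

text \<open>
  Note that 694 = 63 * 11 + 1. Three base blocks of size 7 in the integers modulo 63 whose
  differences cover every residue, including 0, exactly twice form a strong difference family;
  0 is covered because one point is repeated. Pairing the entries of each base block with the
  numbers i < 7 and applying to i all affine maps m i + h modulo 11 with m nonzero separates the
  repeated points and covers exactly twice each pair of points of Z_63 x Z_11 with distinct second
  coordinates. After adjoining one point at infinity, each of the 11 fibres has 64 points and is
  filled with a copy of the 2-(64,7,2) design obtained from a cyclic difference family modulo 64.
\<close>

section \<open>Counting blocks through a pair of points; transport of designs\<close>

text \<open>An injective \<open>b j\<close> determines the positions of \<open>p\<close> and
  \<open>q\<close> in its block, so each index of a block through both yields exactly one triple.
  Counting indices instead of sets keeps multiplicities, and positions are what differences refer to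
  later.\<close>

lemma size_blocks_through_pair:
  fixes b :: "'j \<Rightarrow> nat \<Rightarrow> 'a"
  assumes "finite J" "\<And>j. j \<in> J \<Longrightarrow> inj_on (b j) {..<k}"
  shows "size {# B \<in># image_mset (\<lambda>j. b j ` {..<k}) (mset_set J). {p, q} \<subseteq> B #} =
    card {(j, i, i'). j \<in> J \<and> i < k \<and> i' < k \<and> b j i = p \<and> b j i' = q}" (is "?l = card ?S")
proof -
  have inj: "inj_on fst ?S"
    by (rule inj_onI) (auto dest: inj_onD[OF assms(2)])
  have "?l = card {j \<in> J. {p, q} \<subseteq> b j ` {..<k}}"
    using assms(1) by (simp add: filter_mset_image_mset filter_mset_mset_set del: insert_subset)
  also have "{j \<in> J. {p, q} \<subseteq> b j ` {..<k}} = fst ` ?S"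
    by (force simp: image_iff)
  finally show ?thesis
    by (simp only: card_image[OF inj])
qed

lemma two_designI:
  assumes "finite V" "card V = v"
    and "\<And>B. B \<in># \<A> \<Longrightarrow> B \<subseteq> V \<and> card B = k"
    and "\<And>p q. p \<in> V \<Longrightarrow> q \<in> V \<Longrightarrow> p \<noteq> q \<Longrightarrow> size {# B \<in># \<A>. {p, q} \<subseteq> B #} = l"
  shows "two_design v k l V \<A>"
  unfolding two_design_def
proof (intro conjI ballI allI impI)
  fix T assume "T \<subseteq> V \<and> card T = 2"
  then obtain p q where "T = {p, q}" "p \<noteq> q" "p \<in> V" "q \<in> V"
    by (auto simp: card_2_iff)
  then show "size {# B \<in># \<A>. T \<subseteq> B #} = l"
    using assms(4) by simp
qed (use assms in auto)

lemma two_design_pair: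
  assumes "two_design v k l V \<A>" "p \<in> V" "q \<in> V" "p \<noteq> q"
  shows "size {# B \<in># \<A>. {p, q} \<subseteq> B #} = l"
  using assms unfolding two_design_def by (metis card_2_iff empty_subsetI insert_subset)

text \<open>Serves to copy the small design onto each fibre and to rename the final points as
  natural numbers. Injectivity on \<open>V\<close> is enough because all blocks lie in
  \<open>V\<close>.\<close>

lemma two_design_image:
  assumes des: "two_design v k l V \<A>" and inj: "inj_on f V"
  shows "two_design v k l (f ` V) (image_mset (image f) \<A>)"
proof (rule two_designI)
  show "finite (f ` V)" "card (f ` V) = v"
    using des inj by (auto simp: two_design_def card_image)
next
  fix B assume "B \<in># image_mset (image f) \<A>"
  then obtain C where C: "C \<in># \<A>" "B = f ` C" by auto
  with des have "C \<subseteq> V" "card C = k" by (auto simp: two_design_def)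
  with C inj show "B \<subseteq> f ` V \<and> card B = k"
    by (auto simp: card_image inj_on_subset)
next
  fix p q assume "p \<in> f ` V" "q \<in> f ` V" "p \<noteq> q"
  then obtain x y where xy: "x \<in> V" "y \<in> V" "p = f x" "q = f y" "x \<noteq> y" by auto
  have "{p, q} \<subseteq> f ` B \<longleftrightarrow> {x, y} \<subseteq> B" if "B \<in># \<A>" for B
  proof -
    have "B \<subseteq> V" using that des by (auto simp: two_design_def)
    with xy inj show ?thesis by (simp add: inj_on_image_mem_iff)
  qed
  then have "{# B \<in># \<A>. {p, q} \<subseteq> f ` B #} = {# B \<in># \<A>. {x, y} \<subseteq> B #}"
    by (intro filter_mset_cong) auto
  then show "size {# B \<in># image_mset (image f) \<A>. {p, q} \<subseteq> B #} = l"
    using two_design_pair[OF des xy(1,2,5)] xy(3,4)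
    by (simp add: filter_mset_image_mset del: insert_subset)
qed

section \<open>Filling the fibres of a group divisible design\<close>

text \<open>The point at infinity is \<^term>\<open>None\<close>.\<close>

lemma fill_fibres:
  fixes X :: "'a set" and Y :: "'b set" and \<G> :: "('a \<times> 'b) set multiset"
  assumes fin: "finite X" "finite Y"
    and blocks: "\<And>B. B \<in># \<G> \<Longrightarrow> B \<subseteq> X \<times> Y \<and> card B = k"
    and pairs: "\<And>p q. p \<in> X \<times> Y \<Longrightarrow> q \<in> X \<times> Y \<Longrightarrow> p \<noteq> q \<Longrightarrow>
      size {# B \<in># \<G>. {p, q} \<subseteq> B #} = (if snd p = snd q then 0 else l)"
    and des: "two_design (card X + 1) k l W \<D>"
  shows "\<exists>\<A>. two_design (card X * card Y + 1) k l (insert None (Some ` (X \<times> Y))) \<A>"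
proof -
  \<comment> \<open>The fibre over \<open>c\<close> with infinity added; for distinct indices two
    such sets share only \<open>None\<close>.\<close>
  define F where "F c = insert None ((\<lambda>x. Some (x, c)) ` X)" for c :: 'b
  \<comment> \<open>Any bijection from \<open>W\<close> will do, since only the size
    \<open>card X + 1\<close> of \<open>F c\<close> matters.\<close>
  have "\<exists>\<B>. two_design (card X + 1) k l (F c) \<B>" for c
  proof -
    have "card (F c) = card X + 1"
      unfolding F_def using fin by (subst card_insert_disjoint) (auto simp: card_image inj_on_def)
    moreover have "finite W" "card W = card X + 1"
      using des by (auto simp: two_design_def)
    ultimately obtain f where "bij_betw f W (F c)"
      using finite_same_card_bij[of W "F c"] fin by (auto simp: F_def)
    then show ?thesis
      using two_design_image[OF des, of f] by (auto simp: bij_betw_def)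
  qed
  then obtain \<B> where \<B>: "two_design (card X + 1) k l (F c) (\<B> c)" for c
    by metis
  define \<A> where "\<A> = image_mset (image Some) \<G> + (\<Sum>c\<in>Y. \<B> c)"
  have size_sum: "size (filter_mset P (\<Sum>c\<in>Y. \<B> c)) = (\<Sum>c\<in>Y. size (filter_mset P (\<B> c)))" for P
    using fin(2) by induction auto
  have one_fibre: "size {# B \<in># \<A>. {p, q} \<subseteq> B #} = l"
    if c: "c \<in> Y" and pq: "p \<in> F c" "q \<in> F c" "p \<noteq> q" for c p q
  proof -
    \<comment> \<open>Two distinct points of \<open>F c\<close> cannot both lie in another
      \<open>F d\<close>, so only the filling of the fibre over \<open>c\<close>
      contributes.\<close>
    have "size {# B \<in># \<B> d. {p, q} \<subseteq> B #} = (if d = c then l else 0)" for d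
    proof (cases "d = c")
      case True
      then show ?thesis using two_design_pair[OF \<B> pq] by simp
    next
      case False
      then have "\<not> {p, q} \<subseteq> F d" using pq by (auto simp: F_def)
      then have "\<not> {p, q} \<subseteq> B" if "B \<in># \<B> d" for B
        using \<B>[of d] that unfolding two_design_def by blast
      then show ?thesis using False by (auto simp: filter_mset_eq_conv)
    qed
    then have "(\<Sum>d\<in>Y. size {# B \<in># \<B> d. {p, q} \<subseteq> B #}) = l"
      using c fin by simp
    \<comment> \<open>Images of blocks of \<G> miss infinity, and by \<open>pairs\<close> no block
      of \<G> contains two points of one fibre.\<close>
    moreover have "size {# B \<in># \<G>. {p, q} \<subseteq> Some ` B #} = 0"
    proof (cases "p = None \<or> q = None")
      case False
      then obtain x y where xy: "p = Some (x, c)" "q = Some (y, c)" "x \<in> X" "y \<in> X" "x \<noteq> y"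
        using pq by (auto simp: F_def)
      then have "{p, q} \<subseteq> Some ` B \<longleftrightarrow> {(x, c), (y, c)} \<subseteq> B" for B by auto
      then show ?thesis using pairs[of "(x, c)" "(y, c)"] xy c by simp
    qed auto
    ultimately show ?thesis
      by (simp add: \<A>_def filter_mset_image_mset size_sum del: insert_subset)
  qed
  have two_fibres: "size {# B \<in># \<A>. {Some p, Some q} \<subseteq> B #} = l"
    if pq: "p \<in> X \<times> Y" "q \<in> X \<times> Y" "snd p \<noteq> snd q" for p q
  proof -
    have "size {# B \<in># \<B> d. {Some p, Some q} \<subseteq> B #} = 0" for d
    proof -
      have "\<not> {Some p, Some q} \<subseteq> F d" using pq by (auto simp: F_def)
      then have "\<not> {Some p, Some q} \<subseteq> B" if "B \<in># \<B> d" for B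
        using \<B>[of d] that unfolding two_design_def by blast
      then have "{# B \<in># \<B> d. {Some p, Some q} \<subseteq> B #} = {#}"
        by (auto simp: filter_mset_eq_conv)
      then show ?thesis by (simp only: size_empty)
    qed
    then have "(\<Sum>d\<in>Y. size {# B \<in># \<B> d. {Some p, Some q} \<subseteq> B #}) = 0"
      by (simp only: sum.neutral_const)
    moreover have "{Some p, Some q} \<subseteq> Some ` B \<longleftrightarrow> {p, q} \<subseteq> B" for B by auto
    then have "size {# B \<in># \<G>. {Some p, Some q} \<subseteq> Some ` B #} = l"
      using pairs[of p q] pq by auto
    ultimately show ?thesis
      by (simp add: \<A>_def filter_mset_image_mset size_sum del: insert_subset)
  qed
  have "two_design (card X * card Y + 1) k l (insert None (Some ` (X \<times> Y))) \<A>"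
  proof (rule two_designI)
    show "finite (insert None (Some ` (X \<times> Y)))" using fin by simp
    show "card (insert None (Some ` (X \<times> Y))) = card X * card Y + 1"
      using fin by (subst card_insert_disjoint) (auto simp: card_image card_cartesian_product)
  next
    fix B assume "B \<in># \<A>"
    then consider C where "C \<in># \<G>" "B = Some ` C" | c where "c \<in> Y" "B \<in># \<B> c"
      unfolding \<A>_def using fin by (auto simp: set_mset_sum)
    then show "B \<subseteq> insert None (Some ` (X \<times> Y)) \<and> card B = k"
    proof cases
      case 1
      then show ?thesis using blocks by (fastforce simp: card_image)
    next
      case 2
      then have "F c \<subseteq> insert None (Some ` (X \<times> Y))" by (auto simp: F_def)
      with 2 show ?thesis using \<B>[of c] by (auto simp: two_design_def)
    qed
  next
    fix p q assume pq: "p \<in> insert None (Some ` (X \<times> Y))" "q \<in> insert None (Some ` (X \<times> Y))" "p \<noteq> q"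
    show "size {# B \<in># \<A>. {p, q} \<subseteq> B #} = l"
    proof (cases "\<exists>c\<in>Y. p \<in> F c \<and> q \<in> F c")
      case True
      then show ?thesis using one_fibre pq by blast
    next
      case False
      \<comment> \<open>A pair containing infinity would already lie in \<open>F c\<close> for the
        fibre of its other point.\<close>
      with pq have "p \<noteq> None" "q \<noteq> None" by (auto simp: F_def image_iff)
      with pq obtain p' q' where p'q': "p = Some p'" "q = Some q'" "p' \<in> X \<times> Y" "q' \<in> X \<times> Y"
        by blast
      moreover have "snd p' \<noteq> snd q'" using False p'q' by (auto simp: F_def image_iff)
      ultimately show ?thesis using two_fibres by simp
    qed
  qed
  then show ?thesis ..
qed

section \<open>Cyclic difference families\<close>

text \<open>Positions, not values, are required to be distinct, so a repeated entry represents the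
  difference 0. One notion thus serves ordinary and strong difference families.\<close>

definition diff_reps :: "int \<Rightarrow> nat \<Rightarrow> nat \<Rightarrow> (nat \<Rightarrow> nat \<Rightarrow> int) \<Rightarrow> int \<Rightarrow> (nat \<times> nat \<times> nat) set" where
  "diff_reps n t k a d =
     {(s, i, j). s < t \<and> i < k \<and> j < k \<and> i \<noteq> j \<and> (a s i - a s j) mod n = d mod n}"

lemma shift_mod_eq_iff:
  fixes n x g u :: int
  assumes "g \<in> {0..<n}" "u \<in> {0..<n}"
  shows "(x + g) mod n = u \<longleftrightarrow> g = (u - x) mod n"
proof
  assume "(x + g) mod n = u"
  then have "(u - x) mod n = ((x + g) mod n - x) mod n" by simp
  also have "\<dots> = g" using assms by (simp add: mod_diff_left_eq)
  finally show "g = (u - x) mod n" ..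
next
  assume "g = (u - x) mod n"
  then show "(x + g) mod n = u" using assms by (simp add: mod_add_right_eq)
qed

lemma diff_mod_eq:
  fixes n x y g u w :: int
  assumes "(x + g) mod n = u" "(y + g) mod n = w"
  shows "(x - y) mod n = (u - w) mod n"
proof -
  have "(u - w) mod n = ((x + g) - (y + g)) mod n"
    unfolding assms[symmetric] by (rule mod_diff_eq)
  then show ?thesis by simp
qed

text \<open>A translate of base block \<open>s\<close> with position \<open>i\<close> at
  \<open>u\<close> and position \<open>j\<close> at \<open>w\<close> exists only if the two entries
  differ by \<open>u - w\<close>, and then the shift is forced. Blocks through two points therefore
  correspond to representations of their difference.\<close>

lemma cyclic_difference_family_design:
  assumes n: "n > 0"
    and reps: "\<And>d. d \<in> {0..<n} \<Longrightarrow> card (diff_reps n t k a d) = (if d = 0 then 0 else l)"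
  shows "\<exists>\<A>. two_design (nat n) k l {0..<n} \<A>"
proof -
  define J where "J = {..<t} \<times> {0..<n}"
  define b where "b = (\<lambda>(s, g) i. (a s i + g) mod n)"
  have finJ: "finite J" by (simp add: J_def)
  \<comment> \<open>Infinite sets also have \<open>card\<close> 0, so finiteness is needed to
    conclude emptiness. Emptiness means that entries of a base block are distinct modulo
    \<open>n\<close>, so translates keep \<open>k\<close> points.\<close>
  have "finite (diff_reps n t k a 0)"
    by (rule finite_subset[of _ "{..<t} \<times> {..<k} \<times> {..<k}"]) (auto simp: diff_reps_def)
  then have no0: "diff_reps n t k a 0 = {}" using reps[of 0] n by simp
  have inj: "inj_on (b j) {..<k}" if "j \<in> J" for j
  proof (rule inj_onI, rule ccontr)
    fix i i' assume "i \<in> {..<k}" "i' \<in> {..<k}" "b j i = b j i'" "i \<noteq> i'"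
    moreover obtain s g where "j = (s, g)" by (cases j)
    ultimately have "(s, i, i') \<in> diff_reps n t k a 0"
      using that diff_mod_eq[of "a s i" g n _ "a s i'"] by (auto simp: diff_reps_def b_def J_def)
    with no0 show False by simp
  qed
  have "two_design (nat n) k l {0..<n} (image_mset (\<lambda>j. b j ` {..<k}) (mset_set J))"
  proof (rule two_designI)
    fix B assume "B \<in># image_mset (\<lambda>j. b j ` {..<k}) (mset_set J)"
    then obtain j where "j \<in> J" "B = b j ` {..<k}" using finJ by auto
    then show "B \<subseteq> {0..<n} \<and> card B = k"
      using inj n by (auto simp: card_image b_def split: prod.splits)
  next
    fix u w assume uw: "u \<in> {0..<n}" "w \<in> {0..<n}" "u \<noteq> w"
    let ?S = "{(j, i, i'). j \<in> J \<and> i < k \<and> i' < k \<and> b j i = u \<and> b j i' = w}"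
    have "bij_betw (\<lambda>((s, g), i, j). (s, i, j)) ?S (diff_reps n t k a (u - w))"
    proof (rule bij_betw_byWitness[where f' = "\<lambda>(s, i, j). ((s, (u - a s i) mod n), i, j)"])
      show "(\<lambda>((s, g), i, j). (s, i, j)) ` ?S \<subseteq> diff_reps n t k a (u - w)"
        using uw by (auto simp: diff_reps_def J_def b_def intro: diff_mod_eq)
      show "(\<lambda>(s, i, j). ((s, (u - a s i) mod n), i, j)) ` diff_reps n t k a (u - w) \<subseteq> ?S"
      proof clarify
        fix s i j assume "(s, i, j) \<in> diff_reps n t k a (u - w)"
        then have *: "s < t" "i < k" "j < k" "(a s i - a s j) mod n = (u - w) mod n"
          by (auto simp: diff_reps_def)
        \<comment> \<open>The shift taking position \<open>i\<close> to \<open>u\<close> takes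
          position \<open>j\<close> to \<open>u\<close> minus the difference of the entries, which
          is \<open>w\<close>.\<close>
        have "(a s j + (u - a s i) mod n) mod n = (u - (a s i - a s j)) mod n"
          by (simp add: mod_add_right_eq algebra_simps)
        also have "\<dots> = (u - (u - w)) mod n" by (rule mod_diff_cong[OF refl *(4)])
        finally have "(a s j + (u - a s i) mod n) mod n = w" using uw by simp
        then show "(s, (u - a s i) mod n) \<in> J \<and> i < k \<and> j < k \<and>
            b (s, (u - a s i) mod n) i = u \<and> b (s, (u - a s i) mod n) j = w"
          using * uw n by (simp add: J_def b_def mod_add_right_eq)
      qed
    next
      show "\<forall>z\<in>?S. (\<lambda>(s, i, j). ((s, (u - a s i) mod n), i, j)) ((\<lambda>((s, g), i, j). (s, i, j)) z) = z"
        by (auto simp: J_def b_def mod_diff_left_eq)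
    qed auto
    then have "card ?S = card (diff_reps n t k a (u - w))" by (rule bij_betw_same_card)
    also have "diff_reps n t k a (u - w) = diff_reps n t k a ((u - w) mod n)"
      by (simp add: diff_reps_def)
    also have "(u - w) mod n \<noteq> 0"
      using uw by (auto simp: mod_eq_dvd_iff[symmetric] mod_eq_0_iff_dvd)
    then have "card (diff_reps n t k a ((u - w) mod n)) = l" using reps n by simp
    finally show "size {# B \<in># image_mset (\<lambda>j. b j ` {..<k}) (mset_set J). {u, w} \<subseteq> B #} = l"
      using size_blocks_through_pair[OF finJ inj] by simp
  qed (use n in auto)
  then show ?thesis ..
qed

section \<open>Affine maps modulo a prime and strong difference families\<close>

text \<open>These are two linear equations in slope and intercept over the field with
  \<open>p\<close> elements, uniquely solvable because \<open>i - j\<close> is invertible. Distinct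
  target values make the slope nonzero.\<close>

lemma affine_interpolation:
  fixes p i j x y :: int
  assumes p: "prime p" and ij: "\<not> p dvd i - j" and xy: "x \<in> {0..<p}" "y \<in> {0..<p}" "x \<noteq> y"
  obtains m h where "m \<in> {1..<p}" "h \<in> {0..<p}" "(m * i + h) mod p = x" "(m * j + h) mod p = y"
    "\<And>m' h'. m' \<in> {1..<p} \<Longrightarrow> h' \<in> {0..<p} \<Longrightarrow> (m' * i + h') mod p = x \<Longrightarrow>
       (m' * j + h') mod p = y \<Longrightarrow> m' = m \<and> h' = h"
proof -
  have p0: "p > 0" using p prime_gt_0_int by blast
  have "coprime (i - j) p"
    using p ij by (metis coprime_commute prime_imp_coprime)
  then obtain c where c: "[(i - j) * c = 1] (mod p)"
    using cong_solve_coprime_int by blast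
  \<comment> \<open>The slope is the quotient of \<open>x - y\<close> by \<open>i - j\<close>, with
    \<open>c\<close> inverse to the latter; the intercept is then read off from the value at
    \<open>i\<close>.\<close>
  define m where "m = c * (x - y) mod p"
  define h where "h = (x - m * i) mod p"
  have mij: "[m * (i - j) = x - y] (mod p)"
  proof -
    have "[m * (i - j) = (c * (x - y)) * (i - j)] (mod p)"
      unfolding m_def by (intro cong_mult) auto
    also have "(c * (x - y)) * (i - j) = ((i - j) * c) * (x - y)" by (simp add: algebra_simps)
    also have "[\<dots> = 1 * (x - y)] (mod p)" by (rule cong_scalar_right[OF c])
    finally show ?thesis by simp
  qed
  show thesis
  proof (rule that[of m h])
    have "m \<noteq> 0"
    proof
      assume "m = 0"
      with mij have "[x = y] (mod p)" by (simp add: cong_def mod_eq_dvd_iff dvd_eq_mod_eq_0)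
      with xy show False by (auto simp: cong_def)
    qed
    then show "m \<in> {1..<p}" using p0 
      using pos_mod_bound[OF p0, of "c * (x - y)"] pos_mod_sign[OF p0, of "c * (x - y)"]
      unfolding m_def by simp
    show "h \<in> {0..<p}" using p0 by (simp add: h_def)
    show "(m * i + h) mod p = x" using xy by (simp add: h_def mod_add_right_eq)
    have "[m * j + h = m * j + (x - m * i)] (mod p)"
      unfolding h_def by (intro cong_add) auto
    also have "m * j + (x - m * i) = x - m * (i - j)" by (simp add: algebra_simps)
    also have "[\<dots> = x - (x - y)] (mod p)" by (intro cong_diff mij) auto
    finally show "(m * j + h) mod p = y" using xy by (simp add: cong_def)
  next
    fix m' h' assume *: "m' \<in> {1..<p}" "h' \<in> {0..<p}" "(m' * i + h') mod p = x" "(m' * j + h') mod p = y"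
    have "[m' * (i - j) = x - y] (mod p)"
      using diff_mod_eq[OF *(3,4)] by (simp add: cong_def algebra_simps)
    then have "[c * (m' * (i - j)) = c * (x - y)] (mod p)" by (rule cong_scalar_left)
    moreover have "[c * (m' * (i - j)) = m'] (mod p)"
      using cong_scalar_left[OF c, of m'] by (simp add: algebra_simps)
    ultimately have "m' mod p = m"
      unfolding m_def cong_def by simp
    then have "m' = m" using *(1) by simp
    with * xy shift_mod_eq_iff[of h' p x "m * i"] show "m' = m \<and> h' = h"
      by (simp add: h_def)
  qed
qed

text \<open>The two coordinates decouple: a representation of the first-coordinate difference forces
  the shift, and interpolation at its two positions forces the affine map. Points of different
  fibres may agree in the first coordinate, which is why 0 must be represented \<open>l\<close>
  times too.\<close>

lemma strong_difference_family_gdd: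
  fixes p n :: int
  assumes n: "n > 0" and p: "prime p" and kp: "int k \<le> p"
    and reps: "\<And>d. d \<in> {0..<n} \<Longrightarrow> card (diff_reps n t k a d) = l"
  obtains \<G> where "\<And>B. B \<in># \<G> \<Longrightarrow> B \<subseteq> {0..<n} \<times> {0..<p} \<and> card B = k"
    "\<And>P Q. P \<in> {0..<n} \<times> {0..<p} \<Longrightarrow> Q \<in> {0..<n} \<times> {0..<p} \<Longrightarrow> P \<noteq> Q \<Longrightarrow>
      size {# B \<in># \<G>. {P, Q} \<subseteq> B #} = (if snd P = snd Q then 0 else l)"
proof -
  \<comment> \<open>The indices are base block, shift, slope and intercept. Slope 0 is left out so
    that a block meets each fibre at most once.\<close>
  define J where "J = {..<t} \<times> {0..<n} \<times> {1..<p} \<times> {0..<p}"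
  define b where "b = (\<lambda>(s, g, m, h) i. ((a s i + g) mod n, (m * int i + h) mod p))"
  have p0: "p > 0" using p prime_gt_0_int by blast
  have finJ: "finite J" by (simp add: J_def)
  \<comment> \<open>Positions lie below \<open>k \<le> p\<close>, so distinct positions stay
    distinct modulo \<open>p\<close>.\<close>
  have ndvd: "\<not> p dvd int i - int j" if "i < k" "j < k" "i \<noteq> j" for i j
    using that kp by (auto simp: mod_eq_dvd_iff[symmetric])
  have snd_inj: "i = j" if "i < k" "j < k" "m \<in> {1..<p}"
      "(m * int i + h) mod p = (m * int j + h) mod p" for m h i j
  proof (rule ccontr)
    assume "i \<noteq> j"
    have "p dvd m * (int i - int j)"
      using that(4) by (simp add: mod_eq_dvd_iff algebra_simps)
    moreover have "\<not> p dvd m" using that(3) by (auto dest: zdvd_imp_le)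
    ultimately show False
      using ndvd[OF that(1,2) \<open>i \<noteq> j\<close>] prime_dvd_mult_iff[OF p] by blast
  qed
  have inj: "inj_on (b j) {..<k}" if "j \<in> J" for j
    using that by (auto simp: inj_on_def J_def b_def dest: snd_inj)
  show thesis
  proof (rule that[of "image_mset (\<lambda>j. b j ` {..<k}) (mset_set J)"])
    fix B assume "B \<in># image_mset (\<lambda>j. b j ` {..<k}) (mset_set J)"
    then obtain j where "j \<in> J" "B = b j ` {..<k}" using finJ by auto
    then show "B \<subseteq> {0..<n} \<times> {0..<p} \<and> card B = k"
      using inj n p0 by (auto simp: card_image b_def split: prod.splits)
  next
    fix P Q assume PQ: "P \<in> {0..<n} \<times> {0..<p}" "Q \<in> {0..<n} \<times> {0..<p}" "P \<noteq> Q"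
    obtain u x w y where ux: "P = (u, x)" "Q = (w, y)" by (cases P; cases Q)
    let ?S = "{(j, i, i'). j \<in> J \<and> i < k \<and> i' < k \<and> b j i = P \<and> b j i' = Q}"
    have "card ?S = (if snd P = snd Q then 0 else l)"
    proof (cases "x = y")
      case True
      \<comment> \<open>Equal second coordinates force equal positions in the block, contradicting
        \<open>P \<noteq> Q\<close>.\<close>
      then have "?S = {}"
        using PQ ux by (auto simp: J_def b_def dest: snd_inj)
      then have "card ?S = 0" by (simp only: card.empty)
      then show ?thesis using True ux by simp
    next
      case False
      have uw: "u \<in> {0..<n}" "w \<in> {0..<n}" and xy: "x \<in> {0..<p}" "y \<in> {0..<p}"
        using PQ ux by auto
      \<comment> \<open>Forgetting shift and affine map loses nothing, since \<open>P\<close>,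
        \<open>Q\<close> and the two positions determine them.\<close>
      let ?f = "\<lambda>((s, g, m, h), i, j). (s, i, j)"
      have inj_f: "inj_on ?f ?S"
      proof (rule inj_onI)
        fix z z' assume z: "z \<in> ?S" "z' \<in> ?S" "?f z = ?f z'"
        obtain s g m h i j where z1: "z = ((s, g, m, h), i, j)" by (metis prod.exhaust)
        with z(3) obtain g' m' h' where z2: "z' = ((s, g', m', h'), i, j)" by (cases z') auto
        have *: "(s, g, m, h) \<in> J" "(s, g', m', h') \<in> J" "i < k" "j < k"
          "b (s, g, m, h) i = P" "b (s, g, m, h) j = Q" "b (s, g', m', h') i = P" "b (s, g', m', h') j = Q"
          using z(1,2) z1 z2 by auto
        then have "i \<noteq> j" using PQ by auto
        obtain m0 h0 where "\<And>m' h'. m' \<in> {1..<p} \<Longrightarrow> h' \<in> {0..<p} \<Longrightarrow> (m' * int i + h') mod p = x \<Longrightarrow>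
            (m' * int j + h') mod p = y \<Longrightarrow> m' = m0 \<and> h' = h0"
          by (rule affine_interpolation[OF p ndvd[OF *(3,4) \<open>i \<noteq> j\<close>] xy False]) blast
        with * ux have mh: "m = m0 \<and> h = h0" "m' = m0 \<and> h' = h0" by (auto simp: J_def b_def)
        have g: "g \<in> {0..<n}" "g' \<in> {0..<n}" "(a s i + g) mod n = u" "(a s i + g') mod n = u"
          using *(1,2,5,7) ux by (auto simp: J_def b_def)
        have "g = g'"
          using shift_mod_eq_iff[OF g(1) uw(1), of "a s i"] shift_mod_eq_iff[OF g(2) uw(1), of "a s i"] g(3,4)
          by simp
        with mh show "z = z'" using z1 z2 by simp
      qed
      have img_f: "?f ` ?S = diff_reps n t k a (u - w)"
      proof (intro equalityI subsetI)
        fix z assume "z \<in> ?f ` ?S"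
        then show "z \<in> diff_reps n t k a (u - w)"
          using PQ ux by (auto simp: diff_reps_def J_def b_def intro: diff_mod_eq)
      next
        fix z assume z: "z \<in> diff_reps n t k a (u - w)"
        then obtain s i j where *: "z = (s, i, j)" "s < t" "i < k" "j < k" "i \<noteq> j"
            "(a s i - a s j) mod n = (u - w) mod n"
          by (auto simp: diff_reps_def)
        obtain m h where mh: "m \<in> {1..<p}" "h \<in> {0..<p}"
            "(m * int i + h) mod p = x" "(m * int j + h) mod p = y"
          by (rule affine_interpolation[OF p ndvd[OF *(3-5)] xy False])
        define g where "g = (u - a s i) mod n"
        have "(a s j + g) mod n = (u - (a s i - a s j)) mod n"
          by (simp add: g_def mod_add_right_eq algebra_simps)
        also have "\<dots> = (u - (u - w)) mod n" by (rule mod_diff_cong[OF refl *(6)])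
        finally have "(a s j + g) mod n = w" using uw by simp
        then have "((s, g, m, h), i, j) \<in> ?S"
          using * mh ux uw n by (simp add: J_def b_def g_def mod_add_right_eq)
        then show "z \<in> ?f ` ?S" using * by force
      qed
      have "card ?S = card (diff_reps n t k a (u - w))"
        using card_image[OF inj_f] unfolding img_f by (rule sym)
      also have "diff_reps n t k a (u - w) = diff_reps n t k a ((u - w) mod n)"
        by (simp add: diff_reps_def)
      also have "card \<dots> = l" using reps n by simp
      finally show ?thesis using False ux by simp
    qed
    then show "size {# B \<in># image_mset (\<lambda>j. b j ` {..<k}) (mset_set J). {P, Q} \<subseteq> B #} =
        (if snd P = snd Q then 0 else l)"
      using size_blocks_through_pair[OF finJ inj] by simp
  qed
qed

section \<open>Evaluating the explicit families and assembling the design\<close>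

text \<open>An executable counterpart of \<open>diff_reps\<close>, so that the difference conditions
  can be decided by evaluation.\<close>

definition diff_list :: "int \<Rightarrow> nat \<Rightarrow> nat \<Rightarrow> (nat \<Rightarrow> nat \<Rightarrow> int) \<Rightarrow> int list" where
  "diff_list n t k a = map (\<lambda>(s, i, j). (a s i - a s j) mod n)
     (filter (\<lambda>(s, i, j). i \<noteq> j) (List.product [0..<t] (List.product [0..<k] [0..<k])))"

lemma card_diff_reps:
  assumes "d \<in> {0..<n}"
  shows "card (diff_reps n t k a d) = count_list (diff_list n t k a) d"
proof -
  let ?I = "filter (\<lambda>(s, i, j). i \<noteq> j) (List.product [0..<t] (List.product [0..<k] [0..<k]))"
  let ?P = "(=) d \<circ> (\<lambda>(s, i, j). (a s i - a s j) mod n)"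
  \<comment> \<open>The range assumption gives \<open>d mod n = d\<close>, so reduced differences
    can be compared with \<open>d\<close> itself.\<close>
  have "diff_reps n t k a d = set (filter ?P ?I)"
    using assms by (auto simp: diff_reps_def)
  moreover have "card (set (filter ?P ?I)) = length (filter ?P ?I)"
    by (intro distinct_card distinct_filter distinct_product) auto
  ultimately have "card (diff_reps n t k a d) = length (filter ?P ?I)"
    by (simp only:)
  then show ?thesis
    by (simp add: diff_list_def count_list_eq_length_filter filter_map)
qed

text \<open>
  Both families come from a computer search: fix a random first block and look for two further
  blocks with complementary difference counts.
\<close>

definition sdf63 :: "nat \<Rightarrow> nat \<Rightarrow> int" where
  "sdf63 s i = [[0, 0, 1, 24, 29, 51, 55], [0, 2, 5, 11, 15, 21, 48], [0, 2, 18, 25, 32, 43, 46]] ! s ! i"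

definition df64 :: "nat \<Rightarrow> nat \<Rightarrow> int" where
  "df64 s i = [[0, 1, 5, 7, 20, 48, 58], [0, 1, 5, 23, 25, 34, 37], [0, 3, 15, 24, 34, 42, 50]] ! s ! i"

text \<open>The numbers fit: 3 * 7 * 6 = 126 = 2 * 63. The two representations of 0 come from the
  repeated 0 in the first block, taken in both orders.\<close>

lemma sdf63_differences: "\<forall>d \<in> set [0..62]. count_list (diff_list 63 3 7 sdf63) d = 2"
  by code_simp

text \<open>Here the 126 differences cover the 63 nonzero residues modulo 64 twice each.\<close>

lemma df64_differences:
  "\<forall>d \<in> set [0..63]. count_list (diff_list 64 3 7 df64) d = (if d = 0 then 0 else 2)"
  by code_simp

theorem theorem2p4: "\<exists>(V :: nat set) (\<A> :: nat set multiset). two_design 694 7 2 V \<A>"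
proof -
  have "\<exists>\<D>. two_design (nat 64) 7 2 {0..<64::int} \<D>"
    by (rule cyclic_difference_family_design[of 64 3 7 df64 2]) (use df64_differences in \<open>auto simp: card_diff_reps\<close>)
  then obtain \<D> where \<D>: "two_design 64 7 2 {0..<64::int} \<D>" by auto
  \<comment> \<open>The prime 11 is at least the block size 7, as \<open>kp\<close> demands.\<close>
  obtain \<G> where \<G>: "\<And>B. B \<in># \<G> \<Longrightarrow> B \<subseteq> {0..<63} \<times> {0..<11::int} \<and> card B = 7"
    "\<And>P Q. P \<in> {0..<63::int} \<times> {0..<11::int} \<Longrightarrow> Q \<in> {0..<63} \<times> {0..<11} \<Longrightarrow> P \<noteq> Q \<Longrightarrow>
      size {# B \<in># \<G>. {P, Q} \<subseteq> B #} = (if snd P = snd Q then 0 else 2)"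
    by (rule strong_difference_family_gdd[of 63 11 7 3 sdf63 2])
      (use sdf63_differences in \<open>auto simp: card_diff_reps\<close>)
  obtain \<A> where \<A>: "two_design 694 7 2 (insert None (Some ` ({0..<63::int} \<times> {0..<11::int}))) \<A>"
    using fill_fibres[of "{0..<63::int}" "{0..<11::int}" \<G> 7 2 "{0..<64::int}" \<D>] \<G> \<D> by auto
  \<comment> \<open>So far the points are optional pairs of integers; the statement asks for natural
    numbers, and any injection of the finite point set provides them.\<close>
  obtain f :: "(int \<times> int) option \<Rightarrow> nat"
    where f: "inj_on f (insert None (Some ` ({0..<63::int} \<times> {0..<11::int})))"
    using finite_imp_inj_to_nat_seg[of "insert None (Some ` ({0..<63::int} \<times> {0..<11::int}))"] by auto
  show ?thesis using two_design_image[OF \<A> f] by blast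
qed

end
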